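(* Suppose that $f$ and $s$ are $(M,\alpha)$-Hölder continuous on $[0,1]^d$ (with $M,\alpha>0$), i.e. for $g\in\{f,s\}$ and all $x,y\in[0,1]^d$, $|g(x)-g(y)|\le M\|x-y\|_2^{\alpha}$. Let $K=l^d$ for some integer $l\ge1$ and let $\mathcal N_K$ be the partition of $[0,1]^d$ into $K$ hyper-cubic strata of measure $1/K$ and side length $(1/K)^{1/d}$. Then $$\Sigma_{\mathcal N_K}-\int_{[0,1]^d}s(x)\,dx\le\sqrt{2d}\,M\Big(\frac1K\Big)^{\alpha/d},$$ which implies $$Q_{n,\mathcal N_K}\le\frac{2\sqrt{2d}\,M\,\Sigma_{\mathcal N_1}}{n}\Big(\frac1K\Big)^{\alpha/d},$$ where $\mathcal N_1$ is the partition with the single stratum $[0,1]^d$.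
   Context: Model: $f:[0,1]^d\to\mathbb R$ and $s:[0,1]^d\to[0,\infty)$ are functions; querying a point $x\in[0,1]^d$ returns $f(x)+s(x)\epsilon$, where $\epsilon$ is an independent sample from a distribution $\nu_x$ with mean $0$ and variance $1$ (its shape may depend on $x$). A (measurable) partition $\mathcal N$ of $[0,1]^d$ consists of $K$ Lebesgue measurable strata $\Omega_1,\dots,\Omega_K$ ($K$ finite, arbitrary) of positive Lebesgue measures $w_1,\dots,w_K$. For each stratum, $\mu_k=\frac1{w_k}\int_{\Omega_k}f(x)\,dx$ and $\sigma_k^2=\frac1{w_k}\int_{\Omega_k}\mathbb E_{\epsilon\sim\nu_x}\big[(f(x)+s(x)\epsilon-\mu_k)^2\big]dx$ are the mean and variance of a noisy sample taken at a uniformly random point of $\Omega_k$. $\Sigma_{\mathcal N}=\sum_{k\le K}w_k\sigma_k$. For a budget of $n$ samples, the optimal oracle pseudo-risk on $\mathcal N$ is $L_{n,\mathcal N}(\mathcal A^* )=\Sigma_{\mathcal N}^2/n$, and the quality of the partition is $Q_{n,\mathcal N}=L_{n,\mathcal N}(\mathcal A^* )-\inf_{\mathcal N'\ \text{measurable}}L_{n,\mathcal N'}(\mathcal A^* )$, the infimum being over all measurable partitions with an arbitrary number of strata. *)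

theory Defs
  imports "HOL-Probability.Probability" "HOL-Library.Disjoint_Sets"
begin

definition holder_continuous_on ::
    "real \<Rightarrow> real \<Rightarrow> 'a::metric_space set \<Rightarrow> ('a \<Rightarrow> real) \<Rightarrow> bool" where
  "holder_continuous_on M \<alpha> S g \<longleftrightarrow>
     (\<forall>x\<in>S. \<forall>y\<in>S. \<bar>g x - g y\<bar> \<le> M * dist x y powr \<alpha>)"

definition standardized_noise :: "real measure \<Rightarrow> bool" where
  "standardized_noise N \<longleftrightarrow>
     real_distribution N \<and>
     integrable N (\<lambda>e. e) \<and> integrable N (\<lambda>e. e\<^sup>2) \<and>
     prob_space.expectation N (\<lambda>e. e) = 0 \<and>
     prob_space.variance N (\<lambda>e. e) = 1"

definition unit_cube :: "(real ^ 'd) set" where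
  "unit_cube = cbox 0 1"

definition measurable_partition :: "(real ^ 'd) set set \<Rightarrow> bool" where
  "measurable_partition P \<longleftrightarrow>
     finite P \<and> partition_on unit_cube P \<and>
     (\<forall>\<Omega>\<in>P. \<Omega> \<in> sets lebesgue \<and> measure lebesgue \<Omega> > 0)"

text \<open>Strata are pairwise disjoint, so neighbouring cubes cannot all be closed. A hyper-cube is
  therefore an open axis-parallel cube together with an arbitrary part of its boundary.\<close>

definition hypercube :: "real \<Rightarrow> (real ^ 'd) set \<Rightarrow> bool" where
  "hypercube h \<Omega> \<longleftrightarrow> (\<exists>a. box a (a + vec h) \<subseteq> \<Omega> \<and> \<Omega> \<subseteq> cbox a (a + vec h))"

definition hypercubic_partition :: "nat \<Rightarrow> (real ^ 'd) set set \<Rightarrow> bool" where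
  "hypercubic_partition K P \<longleftrightarrow>
     measurable_partition P \<and> card P = K \<and>
     (\<forall>\<Omega>\<in>P. measure lebesgue \<Omega> = 1 / real K \<and>
             hypercube ((1 / real K) powr (1 / real CARD('d))) \<Omega>)"

definition stratum_mean :: "(real ^ 'd \<Rightarrow> real) \<Rightarrow> (real ^ 'd) set \<Rightarrow> real" where
  "stratum_mean f \<Omega> = 1 / measure lebesgue \<Omega> * (LINT x:\<Omega>|lebesgue. f x)"

definition stratum_variance ::
    "(real ^ 'd \<Rightarrow> real) \<Rightarrow> (real ^ 'd \<Rightarrow> real) \<Rightarrow> (real ^ 'd \<Rightarrow> real measure) \<Rightarrow>
     (real ^ 'd) set \<Rightarrow> real" where
  "stratum_variance f s \<nu> \<Omega> =
     1 / measure lebesgue \<Omega> *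
     (LINT x:\<Omega>|lebesgue. (LINT e|\<nu> x. (f x + s x * e - stratum_mean f \<Omega>)\<^sup>2))"

definition stratum_sd ::
    "(real ^ 'd \<Rightarrow> real) \<Rightarrow> (real ^ 'd \<Rightarrow> real) \<Rightarrow> (real ^ 'd \<Rightarrow> real measure) \<Rightarrow>
     (real ^ 'd) set \<Rightarrow> real" where
  "stratum_sd f s \<nu> \<Omega> = sqrt (stratum_variance f s \<nu> \<Omega>)"

definition partition_sd ::
    "(real ^ 'd \<Rightarrow> real) \<Rightarrow> (real ^ 'd \<Rightarrow> real) \<Rightarrow> (real ^ 'd \<Rightarrow> real measure) \<Rightarrow>
     (real ^ 'd) set set \<Rightarrow> real" where
  "partition_sd f s \<nu> P = (\<Sum>\<Omega>\<in>P. measure lebesgue \<Omega> * stratum_sd f s \<nu> \<Omega>)"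

definition oracle_pseudo_risk ::
    "(real ^ 'd \<Rightarrow> real) \<Rightarrow> (real ^ 'd \<Rightarrow> real) \<Rightarrow> (real ^ 'd \<Rightarrow> real measure) \<Rightarrow>
     nat \<Rightarrow> (real ^ 'd) set set \<Rightarrow> real" where
  "oracle_pseudo_risk f s \<nu> n P = (partition_sd f s \<nu> P)\<^sup>2 / real n"

definition partition_quality ::
    "(real ^ 'd \<Rightarrow> real) \<Rightarrow> (real ^ 'd \<Rightarrow> real) \<Rightarrow> (real ^ 'd \<Rightarrow> real measure) \<Rightarrow>
     nat \<Rightarrow> (real ^ 'd) set set \<Rightarrow> real" where
  "partition_quality f s \<nu> n P =
     oracle_pseudo_risk f s \<nu> n P -
     (INF P'\<in>Collect measurable_partition. oracle_pseudo_risk f s \<nu> n P')"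

lemma hypercube_measure:
  fixes \<Omega> :: "(real ^ 'd) set"
  assumes "hypercube h \<Omega>" and "h \<ge> 0"
  shows "\<Omega> \<in> lmeasurable" and "measure lebesgue \<Omega> = h ^ CARD('d)"
proof -
  from assms(1) obtain a where a: "box a (a + vec h) \<subseteq> \<Omega>" "\<Omega> \<subseteq> cbox a (a + vec h)"
    by (auto simp: hypercube_def)
  have "negligible (cbox a (a + vec h) - box a (a + vec h))"
    by (rule negligible_frontier_interval)
  then have neg: "negligible ((cbox a (a + vec h) - \<Omega>) \<union> (\<Omega> - cbox a (a + vec h)))"
    by (rule negligible_subset) (use a in auto)
  have ne: "cbox a (a + vec h) \<noteq> {}"
    using \<open>h \<ge> 0\<close> by (simp add: interval_ne_empty_cart)
  show "\<Omega> \<in> lmeasurable"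
    using lmeasurable_negligible_symdiff[OF lmeasurable_cbox neg] .
  have "measure lebesgue \<Omega> = measure lebesgue (cbox a (a + vec h))"
    using measure_negligible_symdiff[OF _ neg] by simp
  then show "measure lebesgue \<Omega> = h ^ CARD('d)"
    using content_cbox_cart[OF ne] by simp
qed

lemma hypercube_unit_cube: "hypercube 1 (unit_cube :: (real ^ 'd) set)"
  unfolding hypercube_def unit_cube_def
  by (rule exI[of _ 0]) (auto simp: mem_box_cart less_imp_le)

text \<open>The infimum is over a non-empty set that is bounded below, hence a genuine one.\<close>

lemma measurable_partition_unit_cube: "measurable_partition {unit_cube :: (real ^ 'd) set}"
proof -
  have "(unit_cube :: (real ^ 'd) set) \<in> sets lebesgue"
    "measure lebesgue (unit_cube :: (real ^ 'd) set) = 1"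
    using hypercube_measure[OF hypercube_unit_cube[where 'd='d]] by (auto simp: fmeasurable_def)
  moreover from this have "(unit_cube :: (real ^ 'd) set) \<noteq> {}" by auto
  ultimately show ?thesis
    by (auto simp: measurable_partition_def partition_on_def disjoint_def)
qed

lemma oracle_pseudo_risk_bdd_below:
  "bdd_below (oracle_pseudo_risk f s \<nu> n ` Collect measurable_partition)"
  by (rule bdd_belowI[of _ 0]) (auto simp: oracle_pseudo_risk_def)

text \<open>Sanity check: the regular grid is a hyper-cubic partition.\<close>

lemma hypercubic_partition_exists:
  assumes "l \<ge> 1"
  shows "\<exists>P :: (real ^ 'd) set set. hypercubic_partition (l ^ CARD('d)) P"
proof -
  define idx where "idx x i = min (l - 1) (nat \<lfloor>real l * x $ i\<rfloor>)" for x :: "real ^ 'd" and i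
  define cell where "cell k = {x \<in> unit_cube. idx x = k}" for k
  define A :: "('d \<Rightarrow> nat) set" where "A = UNIV \<rightarrow>\<^sub>E {..<l}"
  have finA: "finite A" and cardA: "card A = l ^ CARD('d)"
    by (auto simp: A_def card_funcsetE intro: finite_PiE)
  have l: "real l > 0" using assms by simp
  have lower: "box (\<chi> i. real (k i) / real l) ((\<chi> i. real (k i) / real l) + vec (1 / real l))
      \<subseteq> cell k" if "k \<in> A" for k
  proof
    fix x assume "x \<in> box (\<chi> i. real (k i) / real l)
      ((\<chi> i. real (k i) / real l) + vec (1 / real l))"
    then have x: "real (k i) < real l * x $ i" "real l * x $ i < real (k i) + 1" for i
      using l by (auto simp: mem_box_cart field_simps)
    have k: "k i < l" for i using that by (auto simp: A_def)
    have "\<lfloor>real l * x $ i\<rfloor> = int (k i)" for i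
      using x[of i] by (intro floor_unique) auto
    then have "idx x i = k i" for i
      using k[of i] by (auto simp: idx_def min_def)
    then have "idx x = k" by blast
    moreover have "0 \<le> x $ i \<and> x $ i \<le> 1" for i
    proof -
      have "0 < real l * x $ i" using x(1)[of i] by (meson of_nat_0_le_iff le_less_trans)
      moreover have "real (k i) + 1 \<le> real l" using k[of i] by linarith
      then have "real l * x $ i < real l * 1" using x(2)[of i] by linarith
      ultimately show ?thesis using l
        by (auto simp: zero_less_mult_iff intro: less_imp_le)
    qed
    ultimately show "x \<in> cell k" by (auto simp: cell_def unit_cube_def mem_box_cart)
  qed
  have upper: "cell k \<subseteq> cbox (\<chi> i. real (k i) / real l)
      ((\<chi> i. real (k i) / real l) + vec (1 / real l))" for k
  proof
    fix x assume "x \<in> cell k"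
    then have 01: "0 \<le> x $ i" "x $ i \<le> 1" and k: "k i = min (l - 1) (nat \<lfloor>real l * x $ i\<rfloor>)" for i
      by (auto simp: cell_def unit_cube_def mem_box_cart idx_def)
    have "real (k i) \<le> real l * x $ i \<and> real l * x $ i \<le> real (k i) + 1" for i
    proof -
      have nn: "0 \<le> real l * x $ i" and le: "real l * x $ i \<le> real l"
        using 01[of i] l by (auto intro: mult_left_le)
      have fl: "real (nat \<lfloor>real l * x $ i\<rfloor>) \<le> real l * x $ i"
        "real l * x $ i < real (nat \<lfloor>real l * x $ i\<rfloor>) + 1"
        using nn by linarith+
      have "real (l - 1) = real l - 1" using assms by simp
      then show ?thesis using fl le k[of i] by (auto simp: min_def)
    qed
    then show "x \<in> cbox (\<chi> i. real (k i) / real l)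
      ((\<chi> i. real (k i) / real l) + vec (1 / real l))"
      using l by (auto simp: mem_box_cart field_simps)
  qed
  have cube: "hypercube (1 / real l) (cell k)" if "k \<in> A" for k
    unfolding hypercube_def using lower[OF that] upper by blast
  have meas: "cell k \<in> sets lebesgue" "measure lebesgue (cell k) = 1 / real (l ^ CARD('d))"
    if "k \<in> A" for k
    using hypercube_measure[OF cube[OF that]] l by (auto simp: fmeasurable_def power_one_over)
  have pos: "measure lebesgue (cell k) > 0" if "k \<in> A" for k
    using meas(2)[OF that] l by simp
  have ne: "cell k \<noteq> {}" if "k \<in> A" for k
    using pos[OF that] by auto
  have "inj_on cell A"
    using ne by (intro inj_onI) (force simp: cell_def)
  then have card: "card (cell ` A) = l ^ CARD('d)"
    by (simp add: card_image cardA)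
  have "idx x \<in> A" for x
    using assms by (auto simp: A_def idx_def)
  then have "\<Union> (cell ` A) = unit_cube"
    by (auto simp: cell_def)
  moreover have "disjoint (cell ` A)"
    by (auto simp: disjoint_def cell_def)
  ultimately have "partition_on unit_cube (cell ` A)"
    using ne by (auto simp: partition_on_def)
  moreover have "(1 / real (l ^ CARD('d))) powr (1 / real CARD('d)) = 1 / real l"
  proof -
    have "1 / real (l ^ CARD('d)) = (1 / real l) powr real CARD('d)"
      using l by (simp add: powr_realpow power_one_over)
    then show ?thesis using l by (simp add: powr_powr)
  qed
  ultimately have "hypercubic_partition (l ^ CARD('d)) (cell ` A)"
    unfolding hypercubic_partition_def measurable_partition_def
    using finA card meas pos cube by auto
  then show ?thesis by blast
qed

end

theory Submission
  imports Defs
begin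

text \<open>
  Averaging over the noise gives \<open>\<sigma>\<^sub>k\<^sup>2 = Var\<^sub>k f + E\<^sub>k s\<^sup>2 = Var\<^sub>k f + Var\<^sub>k s + (E\<^sub>k s)\<^sup>2\<close>, where
  \<open>E\<^sub>k\<close> and \<open>Var\<^sub>k\<close> refer to a uniformly random point of the \<open>k\<close>-th stratum. Everything
  follows from this decomposition.

  On the one hand it gives \<open>\<sigma>\<^sub>k \<ge> E\<^sub>k s\<close>, so \<open>\<Sigma> \<ge> \<integral>s\<close> on every measurable partition
  (\<open>integral_le_partition_sd\<close>): the infimum in the quality is at least \<open>(\<integral>s)\<^sup>2 / n\<close>. On the
  other hand, if \<open>f\<close> and \<open>s\<close> oscillate by at most \<open>D\<close> on the stratum, both variances are at
  most \<open>D\<^sup>2\<close>, so \<open>\<sigma>\<^sub>k \<le> E\<^sub>k s + \<surd>2 D\<close>; summing gives \<open>\<Sigma> - \<integral>s \<le> \<surd>2 D\<close>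
  (\<open>partition_sd_le_integral\<close>).

  A cube of side \<open>h\<close> has diameter \<open>\<surd>d h\<close>, so Hoelder continuity bounds the oscillation by
  \<open>M d\<^bsup>\<alpha>/2\<^esup> h\<^bsup>\<alpha>\<^esup>\<close>. For \<open>\<alpha> \<le> 1\<close> this is at most \<open>M \<surd>d h\<^bsup>\<alpha>\<^esup>\<close>. For \<open>\<alpha> > 1\<close> it need not be,
  but then \<open>f\<close> and \<open>s\<close> are constant and have no oscillation at all (\<open>holder_exponent_gt_1_constant\<close>).

  Finally \<open>\<Sigma>\<^sup>2 - (\<integral>s)\<^sup>2 = (\<Sigma> - \<integral>s)(\<Sigma> + \<integral>s) \<le> (\<Sigma> - \<integral>s) \<cdot> 2\<Sigma>\<close>, and no
  partition has a larger \<open>\<Sigma>\<close> than the one with a single stratum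
  (\<open>partition_sd_le_unit_cube\<close>), which turns the first bound into the second.
\<close>

section \<open>Hoelder continuous functions on cubes\<close>

lemma holder_continuous_on_imp_continuous_on:
  assumes "holder_continuous_on M \<alpha> S g" and "\<alpha> > 0"
  shows "continuous_on S g"
  unfolding continuous_on_def
proof
  fix x assume x: "x \<in> S"
  have "((\<lambda>y. M * dist y x powr \<alpha>) \<longlongrightarrow> M * dist x x powr \<alpha>) (at x within S)"
    using \<open>\<alpha> > 0\<close> by (intro tendsto_intros) auto
  then have lim: "((\<lambda>y. M * dist y x powr \<alpha>) \<longlongrightarrow> 0) (at x within S)"
    by simp
  have "eventually (\<lambda>y. norm (g y - g x) \<le> M * dist y x powr \<alpha>) (at x within S)"
    using assms(1) x by (auto simp: eventually_at_filter holder_continuous_on_def)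
  from Lim_null_comparison[OF this lim] show "(g \<longlongrightarrow> g x) (at x within S)"
    by (simp add: LIM_zero_iff)
qed

text \<open>The difference quotients at \<open>x\<close> are bounded by \<open>M \<parallel>y - x\<parallel>\<^bsup>\<alpha>-1\<^esup>\<close>, so the derivative
  vanishes everywhere.\<close>

lemma holder_exponent_gt_1_constant:
  fixes g :: "'a::real_normed_vector \<Rightarrow> real"
  assumes "holder_continuous_on M \<alpha> S g" and "\<alpha> > 1" and "convex S"
    and "x \<in> S" and "y \<in> S"
  shows "g x = g y"
proof (rule has_derivative_zero_unique[OF \<open>convex S\<close> _ \<open>x \<in> S\<close> \<open>y \<in> S\<close>])
  fix x assume x: "x \<in> S"
  have "((\<lambda>y. M * norm (y - x) powr (\<alpha> - 1)) \<longlongrightarrow> M * norm (x - x) powr (\<alpha> - 1)) (at x within S)"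
    using \<open>\<alpha> > 1\<close> by (intro tendsto_intros) auto
  then have "((\<lambda>y. M * norm (y - x) powr (\<alpha> - 1)) \<longlongrightarrow> 0) (at x within S)"
    by simp
  moreover have "norm (g y - g x - 0) / norm (y - x) \<le> M * norm (y - x) powr (\<alpha> - 1)"
    if "y \<in> S" "y \<noteq> x" for y
  proof -
    have "\<bar>g y - g x\<bar> \<le> M * norm (y - x) powr \<alpha>"
      using assms(1) x that by (simp add: holder_continuous_on_def dist_norm)
    moreover have "norm (y - x) powr \<alpha> = norm (y - x) powr (\<alpha> - 1) * norm (y - x)"
      using that by (simp add: powr_diff)
    ultimately show ?thesis
      using that by (simp add: divide_simps mult.assoc)
  qed
  ultimately show "(g has_derivative (\<lambda>h. 0)) (at x within S)"
    by (intro has_derivativeI_sandwich[where e = 1 and f' = "\<lambda>h. 0"]) auto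
qed

lemma hypercube_dist_le:
  fixes \<Omega> :: "(real ^ 'd) set"
  assumes "hypercube h \<Omega>" and "x \<in> \<Omega>" and "y \<in> \<Omega>"
  shows "dist x y \<le> sqrt (real CARD('d)) * h"
proof -
  from assms obtain a where a: "x \<in> cbox a (a + vec h)" "y \<in> cbox a (a + vec h)"
    by (auto simp: hypercube_def)
  have comp: "\<bar>(x - y) $ i\<bar> \<le> h" for i
    using a by (auto simp: mem_box_cart abs_le_iff dest!: spec[of _ i])
  from comp[of undefined] have h: "0 \<le> h" by linarith
  have "norm (x - y) \<le> norm (vec h :: real ^ 'd)"
    using comp h by (intro norm_le_componentwise_cart) simp
  also have "\<dots> = sqrt (real CARD('d)) * h"
    using h by (simp add: norm_vec_def L2_set_def real_sqrt_mult)
  finally show ?thesis by (simp add: dist_norm)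
qed

lemma hypercube_holder_oscillation:
  fixes \<Omega> :: "(real ^ 'd) set"
  assumes holder: "holder_continuous_on M \<alpha> S g" and "convex S"
    and "M \<ge> 0" and "\<alpha> > 0"
    and cube: "hypercube h \<Omega>" and "\<Omega> \<subseteq> S" and "h \<ge> 0"
    and x: "x \<in> \<Omega>" and y: "y \<in> \<Omega>"
  shows "\<bar>g x - g y\<bar> \<le> sqrt (real CARD('d)) * M * h powr \<alpha>"
proof (cases "\<alpha> > 1")
  case True
  then have "g x = g y"
    using holder_exponent_gt_1_constant[OF holder _ \<open>convex S\<close>] x y \<open>\<Omega> \<subseteq> S\<close> by blast
  then show ?thesis using \<open>M \<ge> 0\<close> by simp
next
  case False
  have d: "1 \<le> sqrt (real CARD('d))" by (simp add: Suc_le_eq)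
  have "\<bar>g x - g y\<bar> \<le> M * dist x y powr \<alpha>"
    using holder x y \<open>\<Omega> \<subseteq> S\<close> by (auto simp: holder_continuous_on_def)
  also have "\<dots> \<le> M * (sqrt (real CARD('d)) * h) powr \<alpha>"
    using hypercube_dist_le[OF cube x y] \<open>M \<ge> 0\<close> \<open>\<alpha> > 0\<close>
    by (intro mult_left_mono powr_mono2) auto
  also have "\<dots> = M * sqrt (real CARD('d)) powr \<alpha> * h powr \<alpha>"
    using \<open>h \<ge> 0\<close> by (simp add: powr_mult)
  also have "\<dots> \<le> M * sqrt (real CARD('d)) powr 1 * h powr \<alpha>"
    using d False \<open>M \<ge> 0\<close> by (intro mult_right_mono mult_left_mono powr_mono) auto
  also have "\<dots> = sqrt (real CARD('d)) * M * h powr \<alpha>"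
    by simp
  finally show ?thesis .
qed

section \<open>Mean and variance over a stratum\<close>

lemma set_integral_square_diff_const:
  fixes g :: "'a \<Rightarrow> real"
  assumes A: "A \<in> fmeasurable N"
    and g: "set_integrable N A g" and g2: "set_integrable N A (\<lambda>x. (g x)\<^sup>2)"
  shows "set_integrable N A (\<lambda>x. (g x - c)\<^sup>2)"
    and "(LINT x:A|N. (g x - c)\<^sup>2) =
      (LINT x:A|N. (g x)\<^sup>2) - 2 * c * (LINT x:A|N. g x) + measure N A * c\<^sup>2"
proof -
  have const: "set_integrable N A (\<lambda>x. c\<^sup>2)"
    using A by (auto simp: set_integrable_def fmeasurable_def)
  have lin: "set_integrable N A (\<lambda>x. 2 * c * g x)"
    using g by simp
  have eq: "(\<lambda>x. (g x - c)\<^sup>2) = (\<lambda>x. ((g x)\<^sup>2 - 2 * c * g x) + c\<^sup>2)"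
    by (auto simp: power2_eq_square algebra_simps)
  show "set_integrable N A (\<lambda>x. (g x - c)\<^sup>2)"
    unfolding eq by (intro set_integral_add set_integral_diff g2 lin const)
  have "(LINT x:A|N. c\<^sup>2) = measure N A * c\<^sup>2"
    using A by (subst set_integral_const) (auto simp: fmeasurable_def)
  then show "(LINT x:A|N. (g x - c)\<^sup>2) =
      (LINT x:A|N. (g x)\<^sup>2) - 2 * c * (LINT x:A|N. g x) + measure N A * c\<^sup>2"
    unfolding eq
    by (simp add: set_integral_add set_integral_diff g2 lin const del: set_integral_mult_right)
       (simp add: mult.assoc)
qed

lemma stratum_bias_variance:
  assumes \<Omega>: "\<Omega> \<in> lmeasurable" "measure lebesgue \<Omega> > 0"
    and g: "set_integrable lebesgue \<Omega> g" and g2: "set_integrable lebesgue \<Omega> (\<lambda>x. (g x)\<^sup>2)"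
  shows "(LINT x:\<Omega>|lebesgue. (g x - c)\<^sup>2) =
    (LINT x:\<Omega>|lebesgue. (g x - stratum_mean g \<Omega>)\<^sup>2)
      + measure lebesgue \<Omega> * (stratum_mean g \<Omega> - c)\<^sup>2"
proof -
  have "(LINT x:\<Omega>|lebesgue. g x) = measure lebesgue \<Omega> * stratum_mean g \<Omega>"
    using \<Omega> by (simp add: stratum_mean_def)
  then show ?thesis
    unfolding set_integral_square_diff_const(2)[OF \<Omega>(1) g g2]
    by (simp add: power2_eq_square algebra_simps)
qed

text \<open>The mean is the best constant approximation in mean square, so it does at least as well
  as any value of \<open>g\<close> on the stratum.\<close>

lemma stratum_square_deviation_le:
  assumes \<Omega>: "\<Omega> \<in> lmeasurable" "measure lebesgue \<Omega> > 0"
    and g: "set_integrable lebesgue \<Omega> g" and g2: "set_integrable lebesgue \<Omega> (\<lambda>x. (g x)\<^sup>2)"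
    and osc: "\<And>x y. x \<in> \<Omega> \<Longrightarrow> y \<in> \<Omega> \<Longrightarrow> \<bar>g x - g y\<bar> \<le> D"
  shows "(LINT x:\<Omega>|lebesgue. (g x - stratum_mean g \<Omega>)\<^sup>2) \<le> measure lebesgue \<Omega> * D\<^sup>2"
proof -
  from \<Omega>(2) have "\<Omega> \<noteq> {}" by auto
  then obtain y where y: "y \<in> \<Omega>" by blast
  have const: "set_integrable lebesgue \<Omega> (\<lambda>x. D\<^sup>2)"
    using \<Omega> by (auto simp: set_integrable_def fmeasurable_def)
  have "(LINT x:\<Omega>|lebesgue. (g x - stratum_mean g \<Omega>)\<^sup>2) \<le> (LINT x:\<Omega>|lebesgue. (g x - g y)\<^sup>2)"
    using stratum_bias_variance[OF \<Omega> g g2, of "g y"] \<Omega>(2) by simp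
  also have "\<dots> \<le> (LINT x:\<Omega>|lebesgue. D\<^sup>2)"
    using osc[OF _ y] set_integral_square_diff_const(1)[OF \<Omega>(1) g g2] const
    by (intro set_integral_mono) (auto simp: abs_le_square_iff[symmetric] intro: order_trans[OF _ abs_ge_self])
  also have "\<dots> = measure lebesgue \<Omega> * D\<^sup>2"
    using \<Omega>(1) by (subst set_integral_const) (auto simp: fmeasurable_def)
  finally show ?thesis .
qed

lemma standardized_noise_second_moment:
  assumes "standardized_noise N"
  shows "(LINT e|N. (a + b * e)\<^sup>2) = a\<^sup>2 + b\<^sup>2"
proof -
  interpret real_distribution N
    using assms by (simp add: standardized_noise_def)
  have int: "integrable N (\<lambda>e. e)" "integrable N (\<lambda>e. e\<^sup>2)" and mean: "expectation (\<lambda>e. e) = 0"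
    and "expectation (\<lambda>e. e\<^sup>2) = 1"
    using assms by (auto simp: standardized_noise_def)
  moreover have "(\<lambda>e. (a + b * e)\<^sup>2) = (\<lambda>e. a\<^sup>2 + 2 * a * b * e + b\<^sup>2 * e\<^sup>2)"
    by (auto simp: power2_eq_square algebra_simps)
  ultimately show ?thesis
    using prob_space by simp
qed

text \<open>Noise is centred and of unit variance at every point, so its only contribution to the
  variance of a sample is \<open>s\<^sup>2\<close>, whatever its shape.\<close>

lemma measure_stratum_variance:
  assumes \<Omega>: "\<Omega> \<in> lmeasurable" "measure lebesgue \<Omega> > 0"
    and noise: "\<And>x. x \<in> \<Omega> \<Longrightarrow> standardized_noise (\<nu> x)"
    and f: "set_integrable lebesgue \<Omega> f" "set_integrable lebesgue \<Omega> (\<lambda>x. (f x)\<^sup>2)"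
    and s2: "set_integrable lebesgue \<Omega> (\<lambda>x. (s x)\<^sup>2)"
  shows "measure lebesgue \<Omega> * stratum_variance f s \<nu> \<Omega> =
    (LINT x:\<Omega>|lebesgue. (f x - stratum_mean f \<Omega>)\<^sup>2) + (LINT x:\<Omega>|lebesgue. (s x)\<^sup>2)"
proof -
  have "(LINT e|\<nu> x. (f x + s x * e - stratum_mean f \<Omega>)\<^sup>2) =
      (f x - stratum_mean f \<Omega>)\<^sup>2 + (s x)\<^sup>2" if "x \<in> \<Omega>" for x
    using standardized_noise_second_moment[OF noise[OF that], of "f x - stratum_mean f \<Omega>" "s x"]
    by (simp add: algebra_simps)
  then have "(LINT x:\<Omega>|lebesgue. (LINT e|\<nu> x. (f x + s x * e - stratum_mean f \<Omega>)\<^sup>2)) =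
      (LINT x:\<Omega>|lebesgue. (f x - stratum_mean f \<Omega>)\<^sup>2 + (s x)\<^sup>2)"
    using \<Omega> by (intro set_lebesgue_integral_cong) (auto simp: fmeasurable_def)
  also have "\<dots> = (LINT x:\<Omega>|lebesgue. (f x - stratum_mean f \<Omega>)\<^sup>2) + (LINT x:\<Omega>|lebesgue. (s x)\<^sup>2)"
    by (intro set_integral_add set_integral_square_diff_const \<Omega> f s2)
  finally show ?thesis
    using \<Omega>(2) by (simp add: stratum_variance_def)
qed

lemma stratum_variance_decomposition:
  assumes \<Omega>: "\<Omega> \<in> lmeasurable" "measure lebesgue \<Omega> > 0"
    and noise: "\<And>x. x \<in> \<Omega> \<Longrightarrow> standardized_noise (\<nu> x)"
    and f: "set_integrable lebesgue \<Omega> f" "set_integrable lebesgue \<Omega> (\<lambda>x. (f x)\<^sup>2)"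
    and s: "set_integrable lebesgue \<Omega> s" "set_integrable lebesgue \<Omega> (\<lambda>x. (s x)\<^sup>2)"
  shows "measure lebesgue \<Omega> * stratum_variance f s \<nu> \<Omega> =
    (LINT x:\<Omega>|lebesgue. (f x - stratum_mean f \<Omega>)\<^sup>2)
      + (LINT x:\<Omega>|lebesgue. (s x - stratum_mean s \<Omega>)\<^sup>2)
      + measure lebesgue \<Omega> * (stratum_mean s \<Omega>)\<^sup>2"
  using measure_stratum_variance[OF \<Omega> noise f s(2)] stratum_bias_variance[OF \<Omega> s, of 0] by simp

lemma set_integral_nonneg_on:
  fixes g :: "'a \<Rightarrow> real"
  assumes "\<And>x. x \<in> A \<Longrightarrow> 0 \<le> g x"
  shows "0 \<le> (LINT x:A|N. g x)"
  unfolding set_lebesgue_integral_def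
  using assms by (intro integral_nonneg_AE AE_I2) (simp add: indicator_def)

text \<open>Dropping both variances from the decomposition leaves \<open>(E\<^sub>k s)\<^sup>2\<close>; this is the price of
  noise that no stratification removes.\<close>

lemma stratum_mean_le_stratum_sd:
  assumes \<Omega>: "\<Omega> \<in> lmeasurable" "measure lebesgue \<Omega> > 0"
    and noise: "\<And>x. x \<in> \<Omega> \<Longrightarrow> standardized_noise (\<nu> x)"
    and f: "set_integrable lebesgue \<Omega> f" "set_integrable lebesgue \<Omega> (\<lambda>x. (f x)\<^sup>2)"
    and s: "set_integrable lebesgue \<Omega> s" "set_integrable lebesgue \<Omega> (\<lambda>x. (s x)\<^sup>2)"
  shows "stratum_mean s \<Omega> \<le> stratum_sd f s \<nu> \<Omega>"
proof -
  have "measure lebesgue \<Omega> * stratum_variance f s \<nu> \<Omega> =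
    (LINT x:\<Omega>|lebesgue. (f x - stratum_mean f \<Omega>)\<^sup>2)
      + (LINT x:\<Omega>|lebesgue. (s x - stratum_mean s \<Omega>)\<^sup>2)
      + measure lebesgue \<Omega> * (stratum_mean s \<Omega>)\<^sup>2"
    by (intro stratum_variance_decomposition \<Omega> noise f s)
  then have "measure lebesgue \<Omega> * (stratum_mean s \<Omega>)\<^sup>2 \<le> measure lebesgue \<Omega> * stratum_variance f s \<nu> \<Omega>"
    by (simp add: set_integral_nonneg_on)
  then show ?thesis
    using \<Omega>(2) by (simp add: stratum_sd_def real_le_rsqrt)
qed

text \<open>With both variances at most \<open>D\<^sup>2\<close>, the claim is \<open>m\<^sup>2 + 2 D\<^sup>2 \<le> (m + \<surd>2 D)\<^sup>2\<close> for
  \<open>m = E\<^sub>k s\<close>, which is where \<open>m \<ge> 0\<close> enters.\<close>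

lemma stratum_sd_le_stratum_mean:
  assumes \<Omega>: "\<Omega> \<in> lmeasurable" "measure lebesgue \<Omega> > 0"
    and noise: "\<And>x. x \<in> \<Omega> \<Longrightarrow> standardized_noise (\<nu> x)"
    and f: "set_integrable lebesgue \<Omega> f" "set_integrable lebesgue \<Omega> (\<lambda>x. (f x)\<^sup>2)"
    and s: "set_integrable lebesgue \<Omega> s" "set_integrable lebesgue \<Omega> (\<lambda>x. (s x)\<^sup>2)"
    and mean: "stratum_mean s \<Omega> \<ge> 0" and "D \<ge> 0"
    and osc: "\<And>x y. x \<in> \<Omega> \<Longrightarrow> y \<in> \<Omega> \<Longrightarrow> \<bar>f x - f y\<bar> \<le> D"
      "\<And>x y. x \<in> \<Omega> \<Longrightarrow> y \<in> \<Omega> \<Longrightarrow> \<bar>s x - s y\<bar> \<le> D"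
  shows "stratum_sd f s \<nu> \<Omega> \<le> stratum_mean s \<Omega> + sqrt 2 * D"
proof -
  have "measure lebesgue \<Omega> * stratum_variance f s \<nu> \<Omega> =
    (LINT x:\<Omega>|lebesgue. (f x - stratum_mean f \<Omega>)\<^sup>2)
      + (LINT x:\<Omega>|lebesgue. (s x - stratum_mean s \<Omega>)\<^sup>2)
      + measure lebesgue \<Omega> * (stratum_mean s \<Omega>)\<^sup>2"
    by (intro stratum_variance_decomposition \<Omega> noise f s)
  then have "measure lebesgue \<Omega> * stratum_variance f s \<nu> \<Omega> \<le>
      measure lebesgue \<Omega> * (2 * D\<^sup>2 + (stratum_mean s \<Omega>)\<^sup>2)"
    using stratum_square_deviation_le[OF \<Omega> f osc(1)] stratum_square_deviation_le[OF \<Omega> s osc(2)]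
    by (simp add: algebra_simps)
  then have "stratum_variance f s \<nu> \<Omega> \<le> 2 * D\<^sup>2 + (stratum_mean s \<Omega>)\<^sup>2"
    using \<Omega>(2) by simp
  also have "\<dots> \<le> (stratum_mean s \<Omega> + sqrt 2 * D)\<^sup>2"
    using mean \<open>D \<ge> 0\<close> by (simp add: power2_sum power_mult_distrib)
  finally show ?thesis
    using mean \<open>D \<ge> 0\<close> by (simp add: stratum_sd_def real_le_lsqrt)
qed

section \<open>Partitions of the unit cube\<close>

lemma continuous_on_unit_cube_set_integrable:
  fixes g :: "real ^ 'd \<Rightarrow> real"
  assumes "continuous_on unit_cube g" and "\<Omega> \<in> sets lebesgue" and "\<Omega> \<subseteq> unit_cube"
  shows "set_integrable lebesgue \<Omega> g"
    and "set_integrable lebesgue \<Omega> (\<lambda>x. (g x)\<^sup>2)"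
proof -
  have int: "set_integrable lebesgue \<Omega> h"
    if "continuous_on unit_cube h" for h :: "real ^ 'd \<Rightarrow> real"
  proof (rule set_integrable_subset[OF _ assms(2,3)])
    show "set_integrable lebesgue unit_cube h"
      using that unfolding unit_cube_def by (rule absolutely_integrable_continuous)
  qed
  show "set_integrable lebesgue \<Omega> g" "set_integrable lebesgue \<Omega> (\<lambda>x. (g x)\<^sup>2)"
    by (intro int continuous_on_power assms(1))+
qed

lemma measurable_partition_stratum:
  fixes P :: "(real ^ 'd) set set"
  assumes "measurable_partition P" and "\<Omega> \<in> P"
  shows "\<Omega> \<subseteq> unit_cube" and "\<Omega> \<in> sets lebesgue" and "\<Omega> \<in> lmeasurable"
    and "measure lebesgue \<Omega> > 0"
proof -
  show sub: "\<Omega> \<subseteq> unit_cube" and meas: "\<Omega> \<in> sets lebesgue" and "measure lebesgue \<Omega> > 0"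
    using assms by (auto simp: measurable_partition_def partition_on_def)
  show "\<Omega> \<in> lmeasurable"
    using sub meas unfolding unit_cube_def by (rule fmeasurableI2[OF lmeasurable_cbox])
qed

lemma measurable_partition_sum_integral:
  fixes g :: "real ^ 'd \<Rightarrow> real"
  assumes P: "measurable_partition P" and g: "set_integrable lebesgue unit_cube g"
  shows "(\<Sum>\<Omega>\<in>P. LINT x:\<Omega>|lebesgue. g x) = (LINT x:unit_cube|lebesgue. g x)"
proof -
  have "disjoint_family_on (\<lambda>\<Omega>. \<Omega>) P" "\<Union> P = unit_cube" "finite P"
    using P by (auto simp: measurable_partition_def partition_on_def disjoint_def disjoint_family_on_def)
  moreover have "set_integrable lebesgue \<Omega> g" if "\<Omega> \<in> P" for \<Omega>
    by (rule set_integrable_subset[OF g measurable_partition_stratum(2,1)[OF P that]])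
  ultimately show ?thesis
    using set_integral_finite_Union[of P "\<lambda>\<Omega>. \<Omega>" lebesgue g] measurable_partition_stratum(2)[OF P]
    by simp
qed

lemma measurable_partition_sum_measure:
  fixes P :: "(real ^ 'd) set set"
  assumes P: "measurable_partition P"
  shows "(\<Sum>\<Omega>\<in>P. measure lebesgue \<Omega>) = 1"
proof -
  have int1: "(LINT x:\<Omega>|lebesgue. (1::real)) = measure lebesgue \<Omega>"
    if "\<Omega> \<in> lmeasurable" for \<Omega> :: "(real ^ 'd) set"
    using that by (subst set_integral_const) (auto simp: fmeasurable_def)
  have cube: "(unit_cube :: (real ^ 'd) set) \<in> lmeasurable"
    "measure lebesgue (unit_cube :: (real ^ 'd) set) = 1"
    using hypercube_measure[OF hypercube_unit_cube[where 'd='d]] by auto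
  have "(\<Sum>\<Omega>\<in>P. measure lebesgue \<Omega>) = (\<Sum>\<Omega>\<in>P. LINT x:\<Omega>|lebesgue. (1::real))"
    using measurable_partition_stratum(3)[OF P] by (simp add: int1)
  also have "\<dots> = 1"
    using cube by (subst measurable_partition_sum_integral[OF P])
      (auto simp: int1 set_integrable_def fmeasurable_def)
  finally show ?thesis .
qed

lemma measurable_partition_sum_stratum_mean:
  assumes P: "measurable_partition P" and g: "set_integrable lebesgue unit_cube g"
  shows "(\<Sum>\<Omega>\<in>P. measure lebesgue \<Omega> * stratum_mean g \<Omega>) = (LINT x:unit_cube|lebesgue. g x)"
proof -
  have "measure lebesgue \<Omega> * stratum_mean g \<Omega> = (LINT x:\<Omega>|lebesgue. g x)" if "\<Omega> \<in> P" for \<Omega>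
    using measurable_partition_stratum(4)[OF P that] by (simp add: stratum_mean_def)
  then show ?thesis
    using measurable_partition_sum_integral[OF P g] by simp
qed

lemma unit_cube_lebesgue: "(unit_cube :: (real ^ 'd) set) \<in> sets lebesgue"
  by (simp add: unit_cube_def)

lemma integral_le_partition_sd:
  fixes f s :: "real ^ 'd \<Rightarrow> real"
  assumes P: "measurable_partition P"
    and noise: "\<And>x. x \<in> unit_cube \<Longrightarrow> standardized_noise (\<nu> x)"
    and f: "continuous_on unit_cube f" and s: "continuous_on unit_cube s"
  shows "(LINT x:unit_cube|lebesgue. s x) \<le> partition_sd f s \<nu> P"
proof -
  have "measure lebesgue \<Omega> * stratum_mean s \<Omega> \<le> measure lebesgue \<Omega> * stratum_sd f s \<nu> \<Omega>"
    if "\<Omega> \<in> P" for \<Omega>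
  proof -
    note \<Omega> = measurable_partition_stratum[OF P that]
    show ?thesis
      using \<Omega>(1,4) noise
      by (intro mult_left_mono stratum_mean_le_stratum_sd \<Omega>(3,4)
          continuous_on_unit_cube_set_integrable[OF f \<Omega>(2,1)]
          continuous_on_unit_cube_set_integrable[OF s \<Omega>(2,1)]) auto
  qed
  then have "(\<Sum>\<Omega>\<in>P. measure lebesgue \<Omega> * stratum_mean s \<Omega>) \<le> partition_sd f s \<nu> P"
    unfolding partition_sd_def by (rule sum_mono)
  then show ?thesis
    using measurable_partition_sum_stratum_mean[OF P]
      continuous_on_unit_cube_set_integrable(1)[OF s unit_cube_lebesgue] by simp
qed

lemma partition_sd_le_integral:
  fixes f s :: "real ^ 'd \<Rightarrow> real"
  assumes P: "measurable_partition P"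
    and noise: "\<And>x. x \<in> unit_cube \<Longrightarrow> standardized_noise (\<nu> x)"
    and f: "continuous_on unit_cube f" and s: "continuous_on unit_cube s"
    and s_nonneg: "\<And>x. x \<in> unit_cube \<Longrightarrow> s x \<ge> 0"
    and "D \<ge> 0"
    and osc: "\<And>\<Omega> x y. \<Omega> \<in> P \<Longrightarrow> x \<in> \<Omega> \<Longrightarrow> y \<in> \<Omega> \<Longrightarrow> \<bar>f x - f y\<bar> \<le> D"
      "\<And>\<Omega> x y. \<Omega> \<in> P \<Longrightarrow> x \<in> \<Omega> \<Longrightarrow> y \<in> \<Omega> \<Longrightarrow> \<bar>s x - s y\<bar> \<le> D"
  shows "partition_sd f s \<nu> P - (LINT x:unit_cube|lebesgue. s x) \<le> sqrt 2 * D"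
proof -
  have "measure lebesgue \<Omega> * stratum_sd f s \<nu> \<Omega> \<le>
      measure lebesgue \<Omega> * stratum_mean s \<Omega> + measure lebesgue \<Omega> * (sqrt 2 * D)"
    if "\<Omega> \<in> P" for \<Omega>
  proof -
    note \<Omega> = measurable_partition_stratum[OF P that]
    have "0 \<le> stratum_mean s \<Omega>"
      using s_nonneg \<Omega>(1) unfolding stratum_mean_def
      by (intro mult_nonneg_nonneg set_integral_nonneg_on) auto
    then have "stratum_sd f s \<nu> \<Omega> \<le> stratum_mean s \<Omega> + sqrt 2 * D"
      using \<Omega>(1) noise osc[OF that] \<open>D \<ge> 0\<close>
      by (intro stratum_sd_le_stratum_mean \<Omega>(3,4)
          continuous_on_unit_cube_set_integrable[OF f \<Omega>(2,1)]
          continuous_on_unit_cube_set_integrable[OF s \<Omega>(2,1)]) auto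
    then have "measure lebesgue \<Omega> * stratum_sd f s \<nu> \<Omega> \<le>
        measure lebesgue \<Omega> * (stratum_mean s \<Omega> + sqrt 2 * D)"
      using \<Omega>(4) by simp
    then show ?thesis by (simp add: distrib_left)
  qed
  then have "partition_sd f s \<nu> P \<le>
      (\<Sum>\<Omega>\<in>P. measure lebesgue \<Omega> * stratum_mean s \<Omega> + measure lebesgue \<Omega> * (sqrt 2 * D))"
    unfolding partition_sd_def by (rule sum_mono)
  also have "\<dots> = (LINT x:unit_cube|lebesgue. s x) + sqrt 2 * D"
    using measurable_partition_sum_measure[OF P] measurable_partition_sum_stratum_mean[OF P]
      continuous_on_unit_cube_set_integrable(1)[OF s unit_cube_lebesgue]
    by (simp add: sum.distrib flip: sum_distrib_right)
  finally show ?thesis by simp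
qed

text \<open>By Jensen's inequality \<open>(\<Sum> w\<^sub>k \<sigma>\<^sub>k)\<^sup>2 \<le> \<Sum> w\<^sub>k \<sigma>\<^sub>k\<^sup>2\<close>. The right-hand side is the total variance
  within the strata, which can only grow when the stratum means of \<open>f\<close> are replaced by its
  global mean.\<close>

lemma partition_sd_le_unit_cube:
  fixes f s :: "real ^ 'd \<Rightarrow> real"
  assumes P: "measurable_partition P"
    and noise: "\<And>x. x \<in> unit_cube \<Longrightarrow> standardized_noise (\<nu> x)"
    and f: "continuous_on unit_cube f" and s: "continuous_on unit_cube s"
  shows "partition_sd f s \<nu> P \<le> partition_sd f s \<nu> {unit_cube}"
proof -
  define S where "S = partition_sd f s \<nu> P"
  define c where "c = stratum_mean f unit_cube"
  have cube: "(unit_cube :: (real ^ 'd) set) \<in> lmeasurable"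
    "measure lebesgue (unit_cube :: (real ^ 'd) set) = 1"
    using hypercube_measure[OF hypercube_unit_cube[where 'd='d]] by auto
  note fi = continuous_on_unit_cube_set_integrable[OF f]
  note si = continuous_on_unit_cube_set_integrable[OF s]
  have within: "measure lebesgue \<Omega> * (stratum_sd f s \<nu> \<Omega>)\<^sup>2 \<le>
      (LINT x:\<Omega>|lebesgue. (f x - c)\<^sup>2) + (LINT x:\<Omega>|lebesgue. (s x)\<^sup>2)" if "\<Omega> \<in> P" for \<Omega>
  proof -
    note \<Omega> = measurable_partition_stratum[OF P that]
    have noise': "standardized_noise (\<nu> x)" if "x \<in> \<Omega>" for x
      using noise \<Omega>(1) that by blast
    have var: "measure lebesgue \<Omega> * stratum_variance f s \<nu> \<Omega> =
        (LINT x:\<Omega>|lebesgue. (f x - stratum_mean f \<Omega>)\<^sup>2) + (LINT x:\<Omega>|lebesgue. (s x)\<^sup>2)"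
      by (rule measure_stratum_variance[OF \<Omega>(3,4) noise' fi[OF \<Omega>(2,1)] si(2)[OF \<Omega>(2,1)]])
    then have "0 \<le> measure lebesgue \<Omega> * stratum_variance f s \<nu> \<Omega>"
      by (simp add: set_integral_nonneg_on)
    then have "0 \<le> stratum_variance f s \<nu> \<Omega>"
      using \<Omega>(4) by (simp add: zero_le_mult_iff)
    then have "measure lebesgue \<Omega> * (stratum_sd f s \<nu> \<Omega>)\<^sup>2 =
        (LINT x:\<Omega>|lebesgue. (f x - stratum_mean f \<Omega>)\<^sup>2) + (LINT x:\<Omega>|lebesgue. (s x)\<^sup>2)"
      by (simp add: stratum_sd_def var)
    also have "(LINT x:\<Omega>|lebesgue. (f x - stratum_mean f \<Omega>)\<^sup>2) \<le> (LINT x:\<Omega>|lebesgue. (f x - c)\<^sup>2)"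
      using stratum_bias_variance[OF \<Omega>(3,4) fi[OF \<Omega>(2,1)], of c] \<Omega>(4) by simp
    finally show ?thesis by simp
  qed
  \<comment> \<open>Jensen's inequality for the square: the weights sum to 1, so the weighted variance of the
    standard deviations around their mean \<open>S\<close> is \<open>\<Sum> w\<^sub>k \<sigma>\<^sub>k\<^sup>2 - S\<^sup>2\<close>.\<close>
  have "0 \<le> (\<Sum>\<Omega>\<in>P. measure lebesgue \<Omega> * (stratum_sd f s \<nu> \<Omega> - S)\<^sup>2)"
    by (intro sum_nonneg) simp
  also have "\<dots> = (\<Sum>\<Omega>\<in>P. measure lebesgue \<Omega> * (stratum_sd f s \<nu> \<Omega>)\<^sup>2
      - 2 * S * (measure lebesgue \<Omega> * stratum_sd f s \<nu> \<Omega>) + S\<^sup>2 * measure lebesgue \<Omega>)"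
    by (intro sum.cong) (auto simp: power2_eq_square algebra_simps)
  also have "\<dots> = (\<Sum>\<Omega>\<in>P. measure lebesgue \<Omega> * (stratum_sd f s \<nu> \<Omega>)\<^sup>2)
      - 2 * S * S + S\<^sup>2 * (\<Sum>\<Omega>\<in>P. measure lebesgue \<Omega>)"
    unfolding S_def partition_sd_def by (simp add: sum.distrib sum_subtractf flip: sum_distrib_left)
  also have "\<dots> = (\<Sum>\<Omega>\<in>P. measure lebesgue \<Omega> * (stratum_sd f s \<nu> \<Omega>)\<^sup>2) - S\<^sup>2"
    by (simp add: measurable_partition_sum_measure[OF P] power2_eq_square)
  finally have "S\<^sup>2 \<le> (\<Sum>\<Omega>\<in>P. measure lebesgue \<Omega> * (stratum_sd f s \<nu> \<Omega>)\<^sup>2)"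
    by simp
  also have "\<dots> \<le> (\<Sum>\<Omega>\<in>P. (LINT x:\<Omega>|lebesgue. (f x - c)\<^sup>2) + (LINT x:\<Omega>|lebesgue. (s x)\<^sup>2))"
    using within by (rule sum_mono)
  also have "\<dots> = (LINT x:unit_cube|lebesgue. (f x - c)\<^sup>2) + (LINT x:unit_cube|lebesgue. (s x)\<^sup>2)"
    using fi[OF unit_cube_lebesgue] si(2)[OF unit_cube_lebesgue] cube(1)
    by (simp add: sum.distrib measurable_partition_sum_integral[OF P] set_integral_square_diff_const(1))
  also have "\<dots> = stratum_variance f s \<nu> unit_cube"
    unfolding c_def
    using measure_stratum_variance[OF cube(1) _ noise fi[OF unit_cube_lebesgue order_refl]
        si(2)[OF unit_cube_lebesgue order_refl]] cube(2) by simp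
  finally have "S \<le> sqrt (stratum_variance f s \<nu> unit_cube)"
    by (rule real_le_rsqrt)
  then show ?thesis
    unfolding S_def[symmetric] by (simp add: partition_sd_def stratum_sd_def cube(2))
qed

text \<open>No partition beats \<open>\<integral>s\<close>, which bounds the infimum in the quality from below.\<close>

lemma partition_quality_le:
  fixes f s :: "real ^ 'd \<Rightarrow> real"
  assumes noise: "\<And>x. x \<in> unit_cube \<Longrightarrow> standardized_noise (\<nu> x)"
    and f: "continuous_on unit_cube f" and s: "continuous_on unit_cube s"
    and s_nonneg: "\<And>x. x \<in> unit_cube \<Longrightarrow> s x \<ge> 0"
  shows "partition_quality f s \<nu> n P \<le>
    ((partition_sd f s \<nu> P)\<^sup>2 - (LINT x:unit_cube|lebesgue. s x)\<^sup>2) / real n"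
proof -
  have I0: "0 \<le> (LINT x:unit_cube|lebesgue. s x)"
    using s_nonneg by (rule set_integral_nonneg_on)
  have "(LINT x:unit_cube|lebesgue. s x)\<^sup>2 / real n \<le>
      (INF P'\<in>Collect measurable_partition. oracle_pseudo_risk f s \<nu> n P')"
  proof (rule cINF_greatest)
    show "Collect measurable_partition \<noteq> ({} :: (real ^ 'd) set set set)"
      using measurable_partition_unit_cube by blast
  next
    fix P' :: "(real ^ 'd) set set"
    assume "P' \<in> Collect measurable_partition"
    then have "(LINT x:unit_cube|lebesgue. s x) \<le> partition_sd f s \<nu> P'"
      using integral_le_partition_sd noise f s by blast
    then show "(LINT x:unit_cube|lebesgue. s x)\<^sup>2 / real n \<le> oracle_pseudo_risk f s \<nu> n P'"
      unfolding oracle_pseudo_risk_def using I0 by (intro divide_right_mono power_mono) auto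
  qed
  then show ?thesis
    by (simp add: partition_quality_def oracle_pseudo_risk_def diff_divide_distrib)
qed

section \<open>Quality of the hyper-cubic partition\<close>

theorem proposition3:
  fixes f s :: "real ^ 'd \<Rightarrow> real"
    and \<nu> :: "real ^ 'd \<Rightarrow> real measure"
    and M \<alpha> :: real
    and l K n :: nat
    and N\<^sub>K :: "(real ^ 'd) set set"
  assumes "M > 0" and "\<alpha> > 0"
    and "\<And>x. x \<in> unit_cube \<Longrightarrow> s x \<ge> 0"
    and "\<And>x. x \<in> unit_cube \<Longrightarrow> standardized_noise (\<nu> x)"
    and "holder_continuous_on M \<alpha> unit_cube f"
    and "holder_continuous_on M \<alpha> unit_cube s"
    and "l \<ge> 1" and "K = l ^ CARD('d)"
    and "hypercubic_partition K N\<^sub>K"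
    and "n \<ge> 1"
  shows "partition_sd f s \<nu> N\<^sub>K - (LINT x:unit_cube|lebesgue. s x)
           \<le> sqrt (2 * real CARD('d)) * M * (1 / real K) powr (\<alpha> / real CARD('d)) \<and>
         partition_quality f s \<nu> n N\<^sub>K
           \<le> 2 * sqrt (2 * real CARD('d)) * M * partition_sd f s \<nu> {unit_cube} / real n
               * (1 / real K) powr (\<alpha> / real CARD('d))"
proof
  note M = assms(1) and \<alpha> = assms(2) and s_nonneg = assms(3) and noise = assms(4)
  define I where "I = (LINT x:unit_cube|lebesgue. s x)"
  define h where "h = (1 / real K) powr (1 / real CARD('d))"
  define B where "B = sqrt (2 * real CARD('d)) * M * (1 / real K) powr (\<alpha> / real CARD('d))"
  define D where "D = sqrt (real CARD('d)) * M * h powr \<alpha>"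
  have f: "continuous_on unit_cube f" and s: "continuous_on unit_cube s"
    using assms(5,6) \<alpha> by (auto intro: holder_continuous_on_imp_continuous_on)
  have P: "measurable_partition N\<^sub>K" and cubes: "\<And>\<Omega>. \<Omega> \<in> N\<^sub>K \<Longrightarrow> hypercube h \<Omega>"
    using assms(9) by (auto simp: hypercubic_partition_def h_def)
  have conv: "convex (unit_cube :: (real ^ 'd) set)"
    by (simp add: unit_cube_def)
  have h: "h \<ge> 0" and D: "D \<ge> 0"
    using M by (auto simp: h_def D_def)
  have osc: "\<bar>g x - g y\<bar> \<le> D"
    if "holder_continuous_on M \<alpha> unit_cube g" "\<Omega> \<in> N\<^sub>K" "x \<in> \<Omega>" "y \<in> \<Omega>" for g \<Omega> x y
    unfolding D_def
    using hypercube_holder_oscillation[OF that(1) conv _ \<alpha> cubes[OF that(2)] _ h that(3,4)]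
      measurable_partition_stratum(1)[OF P that(2)] M by simp
  have "sqrt 2 * D = B"
    by (simp add: D_def B_def h_def powr_powr real_sqrt_mult)
  then have first: "partition_sd f s \<nu> N\<^sub>K - I \<le> B"
    using partition_sd_le_integral[OF P noise f s s_nonneg D osc[OF assms(5)] osc[OF assms(6)]]
    by (simp add: I_def)
  then show "partition_sd f s \<nu> N\<^sub>K - (LINT x:unit_cube|lebesgue. s x)
      \<le> sqrt (2 * real CARD('d)) * M * (1 / real K) powr (\<alpha> / real CARD('d))"
    by (simp add: I_def B_def)
  have lower: "I \<le> partition_sd f s \<nu> N\<^sub>K"
    unfolding I_def by (rule integral_le_partition_sd[OF P noise f s])
  have upper: "partition_sd f s \<nu> N\<^sub>K \<le> partition_sd f s \<nu> {unit_cube}"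
    by (rule partition_sd_le_unit_cube[OF P noise f s])
  have I0: "0 \<le> I"
    unfolding I_def using s_nonneg by (rule set_integral_nonneg_on)
  have "(partition_sd f s \<nu> N\<^sub>K)\<^sup>2 - I\<^sup>2 = (partition_sd f s \<nu> N\<^sub>K - I) * (partition_sd f s \<nu> N\<^sub>K + I)"
    by (simp add: power2_eq_square algebra_simps)
  also have "\<dots> \<le> B * (2 * partition_sd f s \<nu> {unit_cube})"
    using first lower upper I0 by (intro mult_mono) auto
  finally have "((partition_sd f s \<nu> N\<^sub>K)\<^sup>2 - I\<^sup>2) / real n
      \<le> B * (2 * partition_sd f s \<nu> {unit_cube}) / real n"
    by (rule divide_right_mono) simp
  moreover have "partition_quality f s \<nu> n N\<^sub>K \<le> ((partition_sd f s \<nu> N\<^sub>K)\<^sup>2 - I\<^sup>2) / real n"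
    unfolding I_def by (intro partition_quality_le noise f s s_nonneg)
  ultimately have "partition_quality f s \<nu> n N\<^sub>K \<le> B * (2 * partition_sd f s \<nu> {unit_cube}) / real n"
    by linarith
  then show "partition_quality f s \<nu> n N\<^sub>K
      \<le> 2 * sqrt (2 * real CARD('d)) * M * partition_sd f s \<nu> {unit_cube} / real n
          * (1 / real K) powr (\<alpha> / real CARD('d))"
    by (simp add: B_def mult_ac)
qed

end
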